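(* Let $A$ be a unital complex Banach algebra and let $a\in A$. Then the following statements are equivalent: (i) $\sigma(a)$ is at most countable; (ii) $\sigma_{\mathcal{DR}}(a)$ is at most countable. Furthermore, in this case $$\sigma_{\mathcal{DR}}(a)=\sigma_{\mathcal{LD}}(L_a)=\sigma_{\mathcal{RD}}(L_a)=\sigma_{dsc}(L_a)=\sigma_{\mathcal{LD}}(R_a)=\sigma_{\mathcal{RD}}(R_a)=\sigma_{dsc}(R_a).$$
   Context: Let $A$ be a unital complex Banach algebra with unit $e$; $a-\lambda$ means $a-\lambda e$. An element $a\in A$ is Drazin invertible if there exist $b\in A$ and $m\in\mathbb N$ such that $a^mba=a^m$, $bab=b$ and $ab=ba$. The Drazin spectrum is $\sigma_{\mathcal{DR}}(a)=\{\lambda\in\mathbb C: a-\lambda \text{ is not Drazin invertible in } A\}$; $\sigma(a)$ is the usual spectrum. The maps $L_a,R_a\colon A\to A$ are the bounded linear operators $L_a(x)=ax$, $R_a(x)=xa$. For a Banach space $X$ let $L(X)$ be the algebra of bounded linear operators on $X$. For $T\in L(X)$, with null space $N(T)$ and range $R(T)$, the descent and the ascent of $T$ are $d(T)=\inf\{n\ge 0: R(T^n)=R(T^{n+1})\}$ and $a(T)=\inf\{n\ge 0: N(T^n)=N(T^{n+1})\}$, with $\inf\emptyset=\infty$. Let $\mathcal{LD}(X)=\{T\in L(X): a(T)<\infty \text{ and } R(T^{a(T)+1}) \text{ is closed}\}$ and $\mathcal{RD}(X)=\{T\in L(X): d(T)<\infty \text{ and } R(T^{d(T)}) \text{ is closed}\}$.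 The left Drazin, right Drazin and descent spectra of $T$ are $\sigma_{\mathcal{LD}}(T)=\{\lambda\in\mathbb C: T-\lambda\notin\mathcal{LD}(X)\}$, $\sigma_{\mathcal{RD}}(T)=\{\lambda\in\mathbb C: T-\lambda\notin\mathcal{RD}(X)\}$ and $\sigma_{dsc}(T)=\{\lambda\in\mathbb C: d(T-\lambda)=\infty\}$. These are applied to $L_a,R_a\in L(A)$. *)

theory Defs
  imports "HOL-Analysis.Analysis" "HOL-Library.Extended_Nat"
begin

section \<open>Complex Banach spaces and unital complex Banach algebras\<close>

text \<open>
  The distribution only has the real classes. A complex Banach space is rendered as a real one
  with a complex scalar multiplication that extends the real one and has an absolutely
  homogeneous norm.
\<close>

class scaleC = scaleR +
  fixes scaleC :: "complex \<Rightarrow> 'a \<Rightarrow> 'a"  (infixr "*\<^sub>C" 75)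
  assumes scaleR_scaleC: "scaleR r x = scaleC (complex_of_real r) x"

class complex_normed_vector = scaleC + real_normed_vector +
  assumes scaleC_add_right: "c *\<^sub>C (x + y) = c *\<^sub>C x + c *\<^sub>C y"
    and scaleC_add_left: "(c + d) *\<^sub>C x = c *\<^sub>C x + d *\<^sub>C x"
    and scaleC_scaleC: "c *\<^sub>C (d *\<^sub>C x) = (c * d) *\<^sub>C x"
    and scaleC_one: "1 *\<^sub>C x = x"
    and norm_scaleC: "norm (c *\<^sub>C x) = cmod c * norm x"

class complex_banach = complex_normed_vector + banach

text \<open>
  Submultiplicativity of the norm comes from \<open>real_normed_algebra\<close>. The unit comes from
  \<open>monoid_mult\<close> rather than from \<open>real_normed_algebra_1\<close>, so that neither
  \<open>norm 1 = 1\<close> nor \<open>1 \<noteq> 0\<close> is assumed.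
\<close>

class complex_banach_algebra = complex_banach + real_normed_algebra + monoid_mult +
  assumes scaleC_mult_left: "(c *\<^sub>C x) * y = c *\<^sub>C (x * y)"
    and scaleC_mult_right: "x * (c *\<^sub>C y) = c *\<^sub>C (x * y)"

instantiation complex :: complex_banach_algebra
begin
definition scaleC_complex :: "complex \<Rightarrow> complex \<Rightarrow> complex" where
  "scaleC_complex c x = c * x"
instance
  by standard (simp_all add: scaleC_complex_def scaleR_conv_of_real algebra_simps norm_mult)
end


section \<open>Spectra of an element\<close>

definition invertible_elem :: "'a::complex_banach_algebra \<Rightarrow> bool" where
  "invertible_elem a \<longleftrightarrow> (\<exists>b. a * b = 1 \<and> b * a = 1)"

definition spectrum :: "'a::complex_banach_algebra \<Rightarrow> complex set" where
  "spectrum a = {c. \<not> invertible_elem (a - c *\<^sub>C 1)}"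

text \<open>
  Allowing \<open>m = 0\<close> is harmless: the condition for \<open>m\<close> implies the one for \<open>Suc m\<close>.
\<close>

definition drazin_invertible :: "'a::complex_banach_algebra \<Rightarrow> bool" where
  "drazin_invertible a \<longleftrightarrow>
     (\<exists>b. \<exists>m::nat. a ^ m * b * a = a ^ m \<and> b * a * b = b \<and> a * b = b * a)"

definition drazin_spectrum :: "'a::complex_banach_algebra \<Rightarrow> complex set" where
  "drazin_spectrum a = {c. \<not> drazin_invertible (a - c *\<^sub>C 1)}"


section \<open>Bounded operators\<close>

definition bounded_clinear :: "('a::complex_normed_vector \<Rightarrow> 'b::complex_normed_vector) \<Rightarrow> bool" where
  "bounded_clinear T \<longleftrightarrow> bounded_linear T \<and> (\<forall>c x. T (c *\<^sub>C x) = c *\<^sub>C T x)"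

definition null_space :: "('a::zero \<Rightarrow> 'a) \<Rightarrow> 'a set" where
  "null_space T = {x. T x = 0}"

text \<open>In \<^typ>\<open>enat\<close> the infimum of the empty set is \<open>\<infinity>\<close>.\<close>

definition ascent :: "('a::zero \<Rightarrow> 'a) \<Rightarrow> enat" where
  "ascent T = Inf {enat n | n. null_space (T ^^ n) = null_space (T ^^ (n + 1))}"

definition descent :: "('a \<Rightarrow> 'a) \<Rightarrow> enat" where
  "descent T = Inf {enat n | n. range (T ^^ n) = range (T ^^ (n + 1))}"

definition left_drazin_ops :: "('a::complex_banach \<Rightarrow> 'a) set" where
  "left_drazin_ops = {T. bounded_clinear T \<and> ascent T < \<infinity> \<and>
     closed (range (T ^^ (the_enat (ascent T) + 1)))}"

definition right_drazin_ops :: "('a::complex_banach \<Rightarrow> 'a) set" where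
  "right_drazin_ops = {T. bounded_clinear T \<and> descent T < \<infinity> \<and>
     closed (range (T ^^ the_enat (descent T)))}"

definition op_minus_scalar ::
    "('a::complex_banach \<Rightarrow> 'a) \<Rightarrow> complex \<Rightarrow> 'a \<Rightarrow> 'a" where
  "op_minus_scalar T c = (\<lambda>x. T x - c *\<^sub>C x)"

definition left_drazin_spectrum :: "('a::complex_banach \<Rightarrow> 'a) \<Rightarrow> complex set" where
  "left_drazin_spectrum T = {c. op_minus_scalar T c \<notin> left_drazin_ops}"

definition right_drazin_spectrum :: "('a::complex_banach \<Rightarrow> 'a) \<Rightarrow> complex set" where
  "right_drazin_spectrum T = {c. op_minus_scalar T c \<notin> right_drazin_ops}"

definition descent_spectrum :: "('a::complex_banach \<Rightarrow> 'a) \<Rightarrow> complex set" where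
  "descent_spectrum T = {c. descent (op_minus_scalar T c) = \<infinity>}"

definition left_mult :: "'a::complex_banach_algebra \<Rightarrow> 'a \<Rightarrow> 'a" where
  "left_mult a = (\<lambda>x. a * x)"

definition right_mult :: "'a::complex_banach_algebra \<Rightarrow> 'a \<Rightarrow> 'a" where
  "right_mult a = (\<lambda>x. x * a)"

lemma bounded_clinear_left_mult: "bounded_clinear (left_mult a)"
  by (simp add: bounded_clinear_def left_mult_def bounded_linear_mult_right scaleC_mult_right)

lemma bounded_clinear_right_mult: "bounded_clinear (right_mult a)"
  by (simp add: bounded_clinear_def right_mult_def bounded_linear_mult_left scaleC_mult_left)

lemma bounded_clinear_scaleC: "bounded_clinear (\<lambda>x::'a::complex_normed_vector. c *\<^sub>C x)"
proof -
  have "bounded_linear (\<lambda>x::'a. c *\<^sub>C x)"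
    by (rule bounded_linear_intro[where K = "cmod c"])
      (simp_all add: scaleC_add_right scaleR_scaleC scaleC_scaleC norm_scaleC mult.commute)
  then show ?thesis
    by (simp add: bounded_clinear_def scaleC_scaleC mult.commute)
qed

lemma scaleC_diff_right: "c *\<^sub>C (x - y) = c *\<^sub>C x - c *\<^sub>C (y::'a::complex_normed_vector)"
  by (metis add_diff_cancel diff_add_cancel scaleC_add_right)

lemma bounded_clinear_op_minus_scalar:
  assumes "bounded_clinear T"
  shows "bounded_clinear (op_minus_scalar T c)"
  using assms bounded_clinear_scaleC[of c]
  by (auto simp: bounded_clinear_def op_minus_scalar_def scaleC_diff_right
      intro: bounded_linear_sub)

end

theory Submission
  imports Defs
begin

text \<open>
  The product \<open>p\<close> of an element and its Drazin inverse is an idempotent that commutes with both: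
  on the range of \<open>p\<close> the element is invertible, on that of \<open>1 - p\<close> it is nilpotent. Both parts are
  invertible after subtracting a small nonzero scalar, so the points of the spectrum outside the Drazin spectrum
  are isolated (\<open>drazin_invertible_punctured_resolvent\<close>). A set of isolated points in the plane
  is countable, and the Drazin spectrum is part of the spectrum; hence one of the two is countable
  exactly if the other is.

  The equalities are proved pointwise, for \<open>b = a - \<lambda>\<close>. If \<open>b\<close> has a Drazin inverse, then so do
  the operators of multiplication by \<open>b\<close>, and these have finite ascent and descent and closed
  ranges (\<open>drazin_inverse_imp_drazin_ops\<close>). For the converse, countability of the spectrum enters:
  the complement of a countable set is dense, so \<open>\<lambda>\<close> is a limit of resolvent points, and the
  operator \<open>T\<close> of multiplication by \<open>b\<close> is a limit of invertible operators \<open>T - \<mu>\<close>. For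
  such an operator finiteness on one side implies finiteness on the other:

  \<^item> If \<open>T\<close> has finite ascent \<open>k\<close> and \<open>T\<^sup>k\<^sup>+\<^sup>1\<close> has closed range, the open mapping theorem bounds
    \<open>T\<^sup>k\<close> by \<open>T\<^sup>k\<^sup>+\<^sup>1\<close>. This estimate makes the solutions of \<open>(T - \<mu>) x = y\<close> bounded modulo
    the null space as \<open>\<mu>\<close> tends to \<open>0\<close>, so \<open>T\<^sup>k y\<close> is a limit of elements of the range of
    \<open>T\<^sup>k\<^sup>+\<^sup>1\<close>, and the descent is finite (\<open>finite_ascent_closed_range_imp_descent\<close>).

  \<^item> If \<open>T\<close> has finite descent \<open>d\<close>, say \<open>T\<^sup>d = T\<^sup>d\<^sup>+\<^sup>1 C\<close>, then a vector \<open>x\<close> with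
    \<open>T\<^sup>d\<^sup>+\<^sup>1 x = 0\<close> and \<open>T\<^sup>d x \<noteq> 0\<close> could be continued to eigenvectors of \<open>T\<close> for all small \<open>\<mu>\<close>.
    So the ascent is finite as well (\<open>finite_descent_imp_null_space\<close>).

  In every case the descent of the multiplication operator is finite, hence so is its ascent. For
  left multiplication this says that \<open>g = b\<^sup>n\<close> satisfies \<open>g = g\<^sup>2 y\<close> for some \<open>y\<close>, and that
  \<open>g\<^sup>2 x = 0\<close> implies \<open>g x = 0\<close>. From these two facts a Drazin inverse of \<open>b\<close> is computed
  (\<open>two_sided_from_right\<close>, \<open>drazin_invertible_if_power\<close>). Right multiplication is symmetric.
\<close>

section \<open>The open mapping theorem for operators with closed range\<close>

text \<open>
  The range is the countable union of the closures of the images of balls, and as a closed set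
  it is complete; by the Baire category theorem one of these closures has an interior point relative
  to the range.
\<close>

lemma image_balls_somewhere_dense:
  fixes S :: "'a::real_normed_vector \<Rightarrow> 'b::banach"
  assumes "closed (range S)"
  obtains n y r where "0 < r" "y \<in> range S" "ball y r \<inter> range S \<subseteq> closure (S ` ball 0 (real n))"
proof -
  define X where "X = top_of_set (range S)"
  define C where "C n = closure (S ` ball 0 (real n))" for n
  have cm: "completely_metrizable_space X"
    unfolding X_def
    using assms completely_metrizable_space_closedin completely_metrizable_space_euclidean
    by (metis closed_closedin)
  have CR: "C n \<subseteq> range S" for n
    unfolding C_def using assms by (intro closure_minimal) auto
  have U: "(\<Union>n. C n) = range S"
  proof
    show "range S \<subseteq> (\<Union>n. C n)"
    proof
      fix v assume "v \<in> range S"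
      then obtain x where x: "v = S x" by blast
      obtain n where "norm x < real n" using reals_Archimedean2 by blast
      then have "v \<in> S ` ball 0 (real n)" unfolding x by (intro imageI) simp
      then show "v \<in> (\<Union>n. C n)"
        using closure_subset[of "S ` ball 0 (real n)"] unfolding C_def[symmetric] by blast
    qed
  qed (use CR in auto)
  have "\<exists>n. X interior_of (C n) \<noteq> {}"
  proof (rule ccontr)
    assume "\<not> ?thesis"
    then have e: "X interior_of (C n) = {}" for n by blast
    have cl: "closedin X (C n)" for n
      unfolding X_def using CR[of n] by (auto simp: C_def closedin_closed_eq assms)
    have "X interior_of \<Union>(range C) = {}"
      by (rule Baire_category_alt) (use cm e cl in auto)
    moreover have "X interior_of (range S) = range S"
      unfolding X_def by (metis interior_of_topspace topspace_euclidean_subtopology)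
    ultimately show False using U by auto
  qed
  then obtain n y where y: "y \<in> X interior_of (C n)" by blast
  then obtain V where V: "openin X V" "y \<in> V" "V \<subseteq> C n" unfolding interior_of_def by auto
  then obtain W where W: "open W" "V = range S \<inter> W" unfolding X_def openin_open by blast
  then obtain r where "0 < r" "ball y r \<subseteq> W" using V by (meson IntD2 open_contains_ball)
  then show ?thesis
    using V W that[of r y n] unfolding C_def by blast
qed

text \<open>
  One step of the open mapping theorem: every element of the range is reached up to half of its norm
  by a preimage whose norm is controlled. The proof moves the ball of the previous lemma to the
  origin and rescales it.
\<close>

lemma approximate_preimage_bound:
  fixes S :: "'a::real_normed_vector \<Rightarrow> 'b::banach"
  assumes S: "bounded_linear S" and "closed (range S)"
  obtains K where "0 \<le> K"
    "\<And>v. v \<in> range S \<Longrightarrow> \<exists>x. norm x \<le> K * norm v \<and> norm (v - S x) \<le> norm v / 2"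
proof -
  interpret S: bounded_linear S by fact
  obtain n y r where r: "0 < r" and y: "y \<in> range S"
    and sub: "ball y r \<inter> range S \<subseteq> closure (S ` ball 0 (real n))"
    using image_balls_somewhere_dense[OF assms(2)] .
  define K where "K = 4 * real n / r"
  have near: "\<exists>x. norm x < real n \<and> norm (w - S x) < e"
    if "w \<in> range S" "dist y w < r" "0 < e" for w e
  proof -
    have "w \<in> closure (S ` ball 0 (real n))" using sub that by auto
    then obtain u where "u \<in> S ` ball 0 (real n)" "dist u w < e"
      using \<open>0 < e\<close> closure_approachable by blast
    then show ?thesis by (auto simp: dist_norm norm_minus_commute)
  qed
  have approx: "\<exists>x. norm x \<le> K * norm v \<and> norm (v - S x) \<le> norm v / 2" if v: "v \<in> range S" for v
  proof (cases "v = 0")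
    case True then show ?thesis by (intro exI[of _ 0]) (simp add: S.zero)
  next
    case False
    define t where "t = r / (2 * norm v)"
    have t: "0 < t" "t * norm v < r" using False r by (auto simp: t_def)
    have tv: "y + t *\<^sub>R v \<in> range S"
    proof -
      obtain p q where "y = S p" "v = S q" using y v by blast
      then have "y + t *\<^sub>R v = S (p + t *\<^sub>R q)" by (simp add: S.add S.scaleR)
      then show ?thesis by blast
    qed
    \<comment> \<open>approximating both \<open>y + t v\<close> and \<open>y\<close> and subtracting removes the centre of the ball\<close>
    define e where "e = t * norm v / 4"
    have e: "0 < e" using t False by (auto simp: e_def)
    obtain x1 where x1: "norm x1 < real n" "norm (y + t *\<^sub>R v - S x1) < e"
      using near[OF tv _ e] t by (auto simp: dist_norm)
    obtain x2 where x2: "norm x2 < real n" "norm (y - S x2) < e"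
      using near[OF y _ e] r by (auto simp: dist_norm)
    define x where "x = (1 / t) *\<^sub>R (x1 - x2)"
    have "norm (x1 - x2) \<le> 2 * real n" using x1 x2 norm_triangle_ineq4[of x1 x2] by linarith
    then have "norm x \<le> (1 / t) * (2 * real n)" using t by (simp add: x_def divide_right_mono)
    also have "\<dots> = K * norm v" using False r by (simp add: t_def K_def field_simps)
    finally have A: "norm x \<le> K * norm v" .
    have "v - S x = (1 / t) *\<^sub>R ((y + t *\<^sub>R v - S x1) - (y - S x2))"
      using t by (simp add: x_def S.scaleR S.diff algebra_simps)
    moreover have "norm ((y + t *\<^sub>R v - S x1) - (y - S x2)) \<le> 2 * e"
      using norm_triangle_ineq4[of "y + t *\<^sub>R v - S x1" "y - S x2"] x1 x2 by linarith
    ultimately have "norm (v - S x) \<le> (1 / t) * (2 * e)" using t by (simp add: divide_right_mono)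
    also have "\<dots> = norm v / 2" using t by (simp add: e_def)
    finally show ?thesis using A by blast
  qed
  have "0 \<le> K" using r by (simp add: K_def)
  then show ?thesis using approx by (rule that)
qed

text \<open>
  The open mapping theorem for \<open>S\<close> onto its range, stated with a bounded choice of preimages. This
  form avoids the quotient by the null space. The errors of the approximate preimages are corrected
  repeatedly, which gives a geometric series.
\<close>

lemma preimage_bound_closed_range:
  fixes S :: "'a::banach \<Rightarrow> 'b::banach"
  assumes S: "bounded_linear S" and "closed (range S)"
  obtains K where "0 \<le> K" "\<And>x. \<exists>x'. S x' = S x \<and> norm x' \<le> K * norm (S x)"
proof -
  interpret S: bounded_linear S by fact
  obtain K where K: "0 \<le> K"
    "\<And>v. v \<in> range S \<Longrightarrow> \<exists>x. norm x \<le> K * norm v \<and> norm (v - S x) \<le> norm v / 2"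
    using approximate_preimage_bound[OF assms] by metis
  then obtain g where g: "\<And>v. v \<in> range S \<Longrightarrow> norm (g v) \<le> K * norm v"
    "\<And>v. v \<in> range S \<Longrightarrow> norm (v - S (g v)) \<le> norm v / 2" by metis
  have "\<exists>x'. S x' = S x \<and> norm x' \<le> 2 * K * norm (S x)" for x
  proof -
    \<comment> \<open>\<open>w k\<close> is the error left after \<open>k\<close> corrections; it is halved by each of them\<close>
    define w where "w k = ((\<lambda>v. v - S (g v)) ^^ k) (S x)" for k
    have w0: "w 0 = S x" and wS: "w (Suc k) = w k - S (g (w k))" for k
      by (simp_all add: w_def)
    have wr: "w k \<in> range S" for k
    proof (induction k)
      case (Suc k)
      then obtain u where "w k = S u" by blast
      then have "w (Suc k) = S (u - g (w k))" by (simp add: wS S.diff)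
      then show ?case by blast
    qed (simp add: w0)
    have wn: "norm (w k) \<le> norm (S x) * (1/2)^k" for k
    proof (induction k)
      case (Suc k) then show ?case using g(2)[OF wr[of k]] by (simp add: wS)
    qed (simp add: w0)
    have gn: "norm (g (w k)) \<le> K * norm (S x) * (1/2)^k" for k
      using g(1)[OF wr[of k]] mult_left_mono[OF wn[of k] K(1)] by (simp add: mult.assoc)
    have geo: "(\<lambda>k. K * norm (S x) * (1/2::real)^k) sums (K * norm (S x) * 2)"
      using sums_mult[OF geometric_sums[of "1/2::real"], of "K * norm (S x)"] by simp
    have sn: "summable (\<lambda>k. norm (g (w k)))"
      by (rule summable_comparison_test'[OF sums_summable[OF geo]]) (use gn in simp)
    have sg: "summable (\<lambda>k. g (w k))" by (rule summable_norm_cancel[OF sn])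
    have bound: "norm (suminf (\<lambda>k. g (w k))) \<le> 2 * K * norm (S x)"
    proof -
      have "norm (suminf (\<lambda>k. g (w k))) \<le> (\<Sum>k. norm (g (w k)))" by (rule summable_norm[OF sn])
      also have "\<dots> \<le> K * norm (S x) * 2"
        using suminf_le[OF gn sn sums_summable[OF geo]] sums_unique[OF geo] by simp
      finally show ?thesis by (simp add: algebra_simps)
    qed
    have w_lim: "w \<longlonglongrightarrow> 0"
    proof (rule Lim_null_comparison)
      show "\<forall>\<^sub>F k in sequentially. norm (w k) \<le> norm (S x) * (1/2)^k" using wn by simp
      show "(\<lambda>k. norm (S x) * (1/2::real)^k) \<longlonglongrightarrow> 0"
        by (intro tendsto_mult_right_zero LIMSEQ_power_zero) simp
    qed
    have "(\<lambda>k. S (g (w k))) sums (S x - 0)"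
    proof -
      have "(\<lambda>k. w k - w (Suc k)) sums (w 0 - 0)" by (rule telescope_sums'[OF w_lim])
      then show ?thesis by (simp add: wS w0)
    qed
    then have "S (suminf (\<lambda>k. g (w k))) = S x"
      using sums_unique2[OF S.sums[OF summable_sums[OF sg]]] by simp
    with bound show ?thesis by blast
  qed
  then show ?thesis using that[of "2 * K"] K(1) by simp
qed

section \<open>Powers of an operator\<close>

lemma bounded_clinear_funpow:
  assumes "bounded_clinear (T :: 'a::complex_normed_vector \<Rightarrow> 'a)"
  shows "bounded_clinear (T ^^ n)"
proof (induction n)
  case 0 show ?case by (simp add: bounded_clinear_def bounded_linear_ident id_def)
next
  case (Suc n) then show ?case using assms
    by (auto simp: bounded_clinear_def o_def intro: bounded_linear_compose)
qed

lemma bounded_clinear_linear: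
  assumes "bounded_clinear T"
  shows "T (x + y) = T x + T y" "T (x - y) = T x - T y" "T 0 = 0" "T (c *\<^sub>C x) = c *\<^sub>C T x"
  using assms bounded_linear.linear[of T]
  by (auto simp: bounded_clinear_def linear_add linear_diff linear_0)

lemma funpow_commutes:
  assumes "\<And>x. f (g x) = g (f x)"
  shows "(f ^^ n) (g x) = g ((f ^^ n) x)"
  by (induction n) (simp_all add: assms)

text \<open>
  Ascent and descent are infima of this shape; this lemma and the next one turn their finiteness
  into an equation between null spaces or ranges.
\<close>

lemma Inf_enat_less_top_iff: "Inf {enat n | n. P n} < \<infinity> \<longleftrightarrow> (\<exists>n. P n)"
proof
  assume "\<exists>n. P n"
  then obtain n where "P n" by blast
  then have "Inf {enat n | n. P n} \<le> enat n" by (intro Inf_lower) blast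
  then show "Inf {enat n | n. P n} < \<infinity>" using enat_ord_code(4) le_less_trans by blast
qed (auto simp: Inf_enat_def split: if_splits)

lemma the_enat_Inf:
  assumes "Inf {enat n | n. P n} < \<infinity>"
  shows "P (the_enat (Inf {enat n | n. P n}))"
proof -
  have "{enat n | n. P n} \<noteq> {}" using assms unfolding Inf_enat_less_top_iff by blast
  then have "Inf {enat n | n. P n} \<in> {enat n | n. P n}"
    using LeastI_ex[of "\<lambda>x. x \<in> {enat n | n. P n}"] unfolding Inf_enat_def by auto
  then show ?thesis by auto
qed

lemmas ascent_finite_iff =
  Inf_enat_less_top_iff[of "\<lambda>n. null_space (T ^^ n) = null_space (T ^^ (n + 1))"
    for T :: "'a::zero \<Rightarrow> 'a", folded ascent_def]
lemmas descent_finite_iff =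
  Inf_enat_less_top_iff[of "\<lambda>n. range (T ^^ n) = range (T ^^ (n + 1))"
    for T :: "'a \<Rightarrow> 'a", folded descent_def]
lemmas null_space_ascent =
  the_enat_Inf[of "\<lambda>n. null_space (T ^^ n) = null_space (T ^^ (n + 1))"
    for T :: "'a::zero \<Rightarrow> 'a", folded ascent_def]
lemmas range_descent =
  the_enat_Inf[of "\<lambda>n. range (T ^^ n) = range (T ^^ (n + 1))"
    for T :: "'a \<Rightarrow> 'a", folded descent_def]

lemma null_space_stable:
  fixes T :: "'a::zero \<Rightarrow> 'a"
  assumes "null_space (T ^^ n) = null_space (T ^^ (n + 1))"
  shows "null_space (T ^^ (n + j)) = null_space (T ^^ n)"
proof (induction j)
  case (Suc j)
  have "(T ^^ (n + Suc j)) x = 0 \<longleftrightarrow> (T ^^ (n + j)) (T x) = 0" for x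
    by (simp add: funpow_swap1)
  moreover have "(T ^^ (n + j)) (T x) = 0 \<longleftrightarrow> (T ^^ n) (T x) = 0" for x
    using Suc by (auto simp: null_space_def set_eq_iff)
  moreover have "(T ^^ n) (T x) = 0 \<longleftrightarrow> (T ^^ n) x = 0" for x
    using assms by (auto simp: null_space_def set_eq_iff funpow_swap1)
  ultimately show ?case by (auto simp: null_space_def)
qed simp

lemma range_stable:
  fixes T :: "'a \<Rightarrow> 'a"
  assumes "range (T ^^ n) = range (T ^^ (n + 1))"
  shows "range (T ^^ (n + j)) = range (T ^^ n)"
proof (induction j)
  case (Suc j)
  have "range (T ^^ (n + Suc j)) = T ` range (T ^^ (n + j))" by (simp add: image_image)
  also have "\<dots> = range (T ^^ (n + 1))" by (simp add: Suc image_image)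
  finally show ?case using assms by simp
qed simp

section \<open>Operators that are limits of commuting invertible ones\<close>

text \<open>
  Closedness of the range of \<open>T\<^sup>k\<^sup>+\<^sup>1\<close> and equality of the null spaces give
  \<open>\<parallel>T\<^sup>k x\<parallel> \<le> D \<parallel>T\<^sup>k\<^sup>+\<^sup>1 x\<parallel>\<close> for all \<open>x\<close>. Write \<open>y = (T - c) x\<close> with \<open>c\<close> small; then
  \<open>T\<^sup>k y = T\<^sup>k\<^sup>+\<^sup>1 x - c T\<^sup>k x\<close>. The estimate bounds \<open>T\<^sup>k x\<close> independently of \<open>c\<close>, so that
  \<open>T\<^sup>k y\<close> is approximated by \<open>T\<^sup>k\<^sup>+\<^sup>1 x\<close>.
\<close>

lemma finite_ascent_closed_range_imp_descent:
  assumes T: "bounded_clinear (T :: 'a::complex_banach \<Rightarrow> 'a)"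
    and null: "null_space (T ^^ k) = null_space (T ^^ (k + 1))"
    and cl: "closed (range (T ^^ (k + 1)))"
    and lim: "\<And>\<epsilon>. 0 < \<epsilon> \<Longrightarrow> \<exists>c. cmod c < \<epsilon> \<and> surj (op_minus_scalar T c)"
  shows "range (T ^^ k) = range (T ^^ (k + 1))"
proof
  show "range (T ^^ (k + 1)) \<subseteq> range (T ^^ k)"
    by (auto simp: funpow_swap1)
  note lin = bounded_clinear_linear[OF bounded_clinear_funpow[OF T]]
  have bl: "bounded_linear (T ^^ n)" for n
    using bounded_clinear_funpow[OF T] by (simp add: bounded_clinear_def)
  obtain K where K: "0 \<le> K" "\<And>x. \<exists>x'. (T ^^ (k+1)) x' = (T ^^ (k+1)) x \<and> norm x' \<le> K * norm ((T ^^ (k+1)) x)"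
    using preimage_bound_closed_range[OF bl cl] by metis
  obtain B where B: "0 < B" "\<And>x. norm ((T ^^ k) x) \<le> norm x * B"
    using bounded_linear.pos_bounded[OF bl] by metis
  define D where "D = K * B"
  have D0: "0 \<le> D" using K B by (simp add: D_def)
  \<comment> \<open>a short preimage \<open>x'\<close> of \<open>T\<^sup>k\<^sup>+\<^sup>1 x\<close> has the same image as \<open>x\<close> under \<open>T\<^sup>k\<close>\<close>
  have D: "norm ((T ^^ k) x) \<le> D * norm ((T ^^ (k+1)) x)" for x
  proof -
    obtain x' where x': "(T ^^ (k+1)) x' = (T ^^ (k+1)) x" "norm x' \<le> K * norm ((T ^^ (k+1)) x)"
      using K(2) by blast
    have "(T ^^ (k+1)) (x - x') = 0" using lin(2)[of "k+1" x x'] x'(1) by (simp only: diff_self)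
    then have "(T ^^ k) (x - x') = 0" using null unfolding null_space_def by blast
    then have "(T ^^ k) x = (T ^^ k) x'" using lin(2)[of k x x'] by simp
    then have "norm ((T ^^ k) x) \<le> norm x' * B" using B by simp
    also have "\<dots> \<le> (K * norm ((T ^^ (k+1)) x)) * B" using x'(2) B by (intro mult_right_mono) auto
    finally show ?thesis by (simp add: D_def algebra_simps)
  qed
  show "range (T ^^ k) \<subseteq> range (T ^^ (k + 1))"
  proof clarify
    fix y
    have "(T ^^ k) y \<in> closure (range (T ^^ (k + 1)))"
      unfolding closure_approachable
    proof (intro allI impI)
      fix e :: real assume e: "0 < e"
      \<comment> \<open>\<open>M\<close> bounds \<open>T\<^sup>k x\<close> as soon as \<open>c\<close> is so small that \<open>|c| D \<le> 1 / 2\<close>\<close>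
      define M where "M = 2 * D * norm ((T ^^ k) y)"
      have M: "0 \<le> M" using D0 by (simp add: M_def)
      obtain c where c: "cmod c < min (1 / (2 * D + 1)) (e / (M + 1))" "surj (op_minus_scalar T c)"
        using lim[of "min (1 / (2 * D + 1)) (e / (M + 1))"] e M D0 by auto
      obtain x where "y = op_minus_scalar T c x" using c(2) by blast
      then have Ty: "(T ^^ k) y = (T ^^ (k+1)) x - c *\<^sub>C (T ^^ k) x"
        by (simp add: op_minus_scalar_def lin funpow_swap1)
      have cD: "cmod c * D \<le> 1 / 2"
      proof -
        have "cmod c * (2 * D + 1) \<le> 1" using c(1) D0 by (simp add: field_simps)
        then show ?thesis using norm_ge_zero[of c] by (simp add: algebra_simps del: norm_ge_zero)
      qed
      have "norm (c *\<^sub>C (T ^^ k) x) \<le> cmod c * (D * norm ((T ^^ (k+1)) x))"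
        unfolding norm_scaleC by (intro mult_left_mono D) simp
      also have "\<dots> \<le> norm ((T ^^ (k+1)) x) / 2"
        using mult_right_mono[OF cD norm_ge_zero[of "(T ^^ (k+1)) x"]] by (simp add: algebra_simps)
      finally have "norm ((T ^^ (k+1)) x) \<le> norm ((T ^^ k) y) + norm ((T ^^ (k+1)) x) / 2"
        using norm_triangle_ineq[of "(T ^^ k) y" "c *\<^sub>C (T ^^ k) x"] unfolding Ty by simp
      then have "norm ((T ^^ (k+1)) x) \<le> 2 * norm ((T ^^ k) y)" by simp
      then have "norm ((T ^^ k) x) \<le> M"
        using order_trans[OF D mult_left_mono[OF _ D0]] unfolding M_def by (metis mult.assoc mult.left_commute)
      then have "norm (c *\<^sub>C (T ^^ k) x) \<le> cmod c * M"
        unfolding norm_scaleC by (intro mult_left_mono) auto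
      also have "\<dots> \<le> cmod c * (M + 1)" by (intro mult_left_mono) auto
      also have "\<dots> < e" using c(1) M by (simp add: field_simps)
      finally have "dist ((T ^^ (k+1)) x) ((T ^^ k) y) < e" by (simp add: dist_norm Ty)
      then show "\<exists>z\<in>range (T ^^ (k + 1)). dist z ((T ^^ k) y) < e" by blast
    qed
    then show "(T ^^ k) y \<in> range (T ^^ (k + 1))" using cl by simp
  qed
qed

text \<open>
  The Neumann series for \<open>1 - C\<close>, replaced by the fixed point of a contraction.
\<close>

lemma affine_fixed_point:
  fixes C :: "'a::banach \<Rightarrow> 'a"
  assumes "bounded_linear C" "0 \<le> q" "q < 1" "\<And>v. norm (C v) \<le> q * norm v"
  shows "\<exists>z. z = x + C z"
proof -
  interpret bounded_linear C by fact
  have "\<exists>!z. x + C z = z"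
    by (rule banach_fix_type[OF assms(2,3)]) (use assms(4) in \<open>auto simp: dist_norm simp flip: diff\<close>)
  then show ?thesis by metis
qed

text \<open>
  The operator \<open>C\<close> witnesses that \<open>T\<close> has finite descent. Let \<open>T\<^sup>d\<^sup>+\<^sup>1 x = 0\<close> and solve
  \<open>z = x + c C z\<close> for small \<open>c\<close>. Then
  \<open>(T - c) T\<^sup>d z = T\<^sup>d\<^sup>+\<^sup>1 z - c T\<^sup>d\<^sup>+\<^sup>1 C z = T\<^sup>d\<^sup>+\<^sup>1 x = 0\<close>, and if \<open>T - c\<close> is injective, \<open>z\<close> lies in
  the null space of \<open>T\<^sup>d\<close>. Since \<open>z\<close> tends to \<open>x\<close> as \<open>c\<close> tends to \<open>0\<close>, so does \<open>x\<close>.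
\<close>

lemma finite_descent_imp_null_space:
  assumes T: "bounded_clinear (T :: 'a::complex_banach \<Rightarrow> 'a)" and C: "bounded_linear C"
    and TC: "\<And>x. (T ^^ d) x = (T ^^ (d + 1)) (C x)"
    and lim: "\<And>\<epsilon>. 0 < \<epsilon> \<Longrightarrow> \<exists>c. cmod c < \<epsilon> \<and> inj (op_minus_scalar T c)"
  shows "null_space (T ^^ d) = null_space (T ^^ (d + 1))"
proof
  show "null_space (T ^^ d) \<subseteq> null_space (T ^^ (d + 1))"
    using bounded_clinear_linear(3)[OF T] by (auto simp: null_space_def)
  note lin = bounded_clinear_linear[OF bounded_clinear_funpow[OF T]]
  note linT = bounded_clinear_linear[OF T]
  have bl: "bounded_linear (T ^^ d)"
    using bounded_clinear_funpow[OF T] by (simp add: bounded_clinear_def)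
  obtain B where B: "0 < B" "\<And>v. norm (C v) \<le> norm v * B"
    using bounded_linear.pos_bounded[OF C] by metis
  show "null_space (T ^^ (d + 1)) \<subseteq> null_space (T ^^ d)"
  proof
    fix x assume "x \<in> null_space (T ^^ (d + 1))"
    then have x: "(T ^^ (d + 1)) x = 0" unfolding null_space_def by blast
    have "x \<in> closure {z. (T ^^ d) z = 0}"
      unfolding closure_approachable
    proof (intro allI impI)
      fix e :: real assume e: "0 < e"
      \<comment> \<open>\<open>|c| B \<le> 1 / 2\<close> makes \<open>v \<mapsto> x + c C v\<close> a contraction with \<open>\<parallel>z\<parallel> \<le> 2 \<parallel>x\<parallel>\<close>, and \<open>|c| M < e\<close> then
      brings \<open>z\<close> within \<open>e\<close> of \<open>x\<close>\<close>
    define M where "M = 2 * B * norm x + 1"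
      have M: "0 < M" using B by (simp add: M_def add_nonneg_pos)
      obtain c where c: "cmod c < min (1 / (2 * B)) (e / M)" "inj (op_minus_scalar T c)"
        using lim[of "min (1 / (2 * B)) (e / M)"] e B M by auto
      have q: "cmod c * B \<le> 1 / 2" using c(1) B by (simp add: field_simps)
      have Cb: "norm (c *\<^sub>C C v) \<le> (cmod c * B) * norm v" for v
        unfolding norm_scaleC using mult_left_mono[OF B(2)[of v] norm_ge_zero[of c]]
        by (simp add: algebra_simps)
      have "bounded_linear (\<lambda>v. c *\<^sub>C C v)"
        using bounded_clinear_scaleC[of c] C bounded_linear_compose unfolding bounded_clinear_def by blast
      then obtain z where z: "z = x + c *\<^sub>C C z"
        using affine_fixed_point[of "\<lambda>v. c *\<^sub>C C v" "cmod c * B" x] q Cb B by auto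
      have half: "norm (c *\<^sub>C C z) \<le> (1 / 2) * norm z"
        using order_trans[OF Cb mult_right_mono[OF q norm_ge_zero]] .
      then have "norm z \<le> 2 * norm x"
        using norm_triangle_ineq[of x "c *\<^sub>C C z"] z by simp
      then have "norm (c *\<^sub>C C z) \<le> (cmod c * B) * (2 * norm x)"
        using order_trans[OF Cb mult_left_mono] B by (simp add: mult_left_mono)
      also have "\<dots> \<le> cmod c * M" by (simp add: M_def algebra_simps)
      also have "\<dots> < e" using c(1) M by (simp add: field_simps)
      finally have "dist z x < e" using z by (metis add_diff_cancel_left' dist_norm)
      moreover have "(T ^^ d) z = 0"
      proof -
        have "op_minus_scalar T c ((T ^^ d) z) = (T ^^ (d + 1)) z - c *\<^sub>C (T ^^ (d + 1)) (C z)"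
          unfolding op_minus_scalar_def TC[of z, symmetric] by simp
        also have "\<dots> = (T ^^ (d + 1)) (z - c *\<^sub>C C z)" by (simp only: lin)
        also have "\<dots> = (T ^^ (d + 1)) x" using z by (metis add_diff_cancel_right')
        also have "\<dots> = op_minus_scalar T c 0"
          unfolding x op_minus_scalar_def linT(3) bounded_clinear_linear(3)[OF bounded_clinear_scaleC]
          by simp
        finally show ?thesis using c(2) by (simp add: inj_eq)
      qed
      ultimately show "\<exists>z\<in>{z. (T ^^ d) z = 0}. dist z x < e" by blast
    qed
    moreover have "closed {z. (T ^^ d) z = 0}"
      by (intro closed_Collect_eq continuous_intros bounded_linear.continuous_on[OF bl])
    ultimately show "x \<in> null_space (T ^^ d)" by (simp add: null_space_def)
  qed
qed

section \<open>Operators with a Drazin inverse\<close>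

text \<open>
  The range of \<open>T\<^sup>n\<close> is the range of the projection \<open>B T\<close>, hence closed, for every \<open>n\<close> with
  \<open>T\<^sup>n B T = T\<^sup>n\<close>. The exponent \<open>m\<close> has this property and shows that ascent and descent are finite.
  The definitions ask for closed ranges at the ascent and the descent themselves, so the proof
  checks that these exponents inherit the property from \<open>m\<close>.
\<close>

lemma drazin_inverse_imp_drazin_ops:
  assumes T: "bounded_clinear (T :: 'a::complex_banach \<Rightarrow> 'a)" and B: "bounded_linear B"
    and TBT: "\<And>x. (T ^^ m) (B (T x)) = (T ^^ m) x"
    and BTB: "\<And>x. B (T (B x)) = B x" and comm: "\<And>x. T (B x) = B (T x)"
  shows "T \<in> left_drazin_ops" "T \<in> right_drazin_ops"
proof -
  note lin = bounded_clinear_linear[OF bounded_clinear_funpow[OF T]]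
  have BTn: "(T ^^ n) (B x) = B ((T ^^ n) x)" for n x by (rule funpow_commutes) (rule comm)
  have Pn: "(T ^^ n) (B (T x)) = B (T ((T ^^ n) x))" for n x
    by (simp add: BTn funpow_swap1)
  have range_eq: "range (T ^^ n) = {x. B (T x) = x}" if n: "\<And>x. (T ^^ n) (B (T x)) = (T ^^ n) x" for n
  proof (intro set_eqI iffI)
    fix x assume "x \<in> range (T ^^ n)" then show "x \<in> {x. B (T x) = x}" using n Pn by auto
  next
    fix x assume "x \<in> {x. B (T x) = x}"
    then have x: "B (T x) = x" by simp
    have "(T ^^ j) ((B ^^ j) x) = x" for j
    proof (induction j)
      case (Suc j)
      have "(T ^^ Suc j) ((B ^^ Suc j) x) = T (B ((T ^^ j) ((B ^^ j) x)))" by (simp add: BTn)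
      then show ?case using Suc x comm by simp
    qed simp
    then show "x \<in> range (T ^^ n)" by (metis rangeI)
  qed
  have cl: "closed {x. B (T x) = x}"
    using T B unfolding bounded_clinear_def
    by (intro closed_Collect_eq continuous_intros bounded_linear.continuous_on[of B]
        bounded_linear.continuous_on[of T]) auto
  have step: "(T ^^ (n + 1)) (B (T x)) = (T ^^ (n + 1)) x"
    if "\<And>x. (T ^^ n) (B (T x)) = (T ^^ n) x" for n x
    using that[of x] by simp
  have "(T ^^ m) x = 0 \<longleftrightarrow> (T ^^ (m + 1)) x = 0" for x
  proof
    assume x: "(T ^^ (m + 1)) x = 0"
    have "(T ^^ m) x = B ((T ^^ (m + 1)) x)" using TBT[of x] Pn[of m x] by simp
    then show "(T ^^ m) x = 0"
      unfolding x using B by (simp add: linear_0 bounded_linear.linear)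
  next
    assume "(T ^^ m) x = 0"
    then show "(T ^^ (m + 1)) x = 0" using bounded_clinear_linear(3)[OF T] by simp
  qed
  then have "null_space (T ^^ m) = null_space (T ^^ (m + 1))" by (simp only: null_space_def)
  then have asc: "ascent T < \<infinity>" unfolding ascent_finite_iff by (rule exI)
  have "range (T ^^ m) = range (T ^^ (m + 1))"
    using range_eq[OF TBT] range_eq[OF step[OF TBT]] by simp
  then have dsc: "descent T < \<infinity>" unfolding descent_finite_iff by (rule exI)
  define k where "k = the_enat (ascent T)"
  have k: "null_space (T ^^ k) = null_space (T ^^ (k + 1))"
    unfolding k_def by (rule null_space_ascent[OF asc])
  have "(T ^^ k) (B (T x)) = (T ^^ k) x" for x
  proof -
    have "(T ^^ m) (B (T x) - x) = 0" using lin TBT by simp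
    then have "(T ^^ (k + m)) (B (T x) - x) = 0" using lin(3)[of k] by (simp add: funpow_add)
    then have "(T ^^ k) (B (T x) - x) = 0"
      using null_space_stable[OF k, of m] by (auto simp: null_space_def)
    then show ?thesis using lin by simp
  qed
  then have "closed (range (T ^^ (k + 1)))" using range_eq[OF step] cl by simp
  then show "T \<in> left_drazin_ops" using T asc by (simp add: left_drazin_ops_def k_def)
  define d where "d = the_enat (descent T)"
  have d: "range (T ^^ d) = range (T ^^ (d + 1))"
    unfolding d_def by (rule range_descent[OF dsc])
  have "(T ^^ d) (B (T x)) = (T ^^ d) x" for x
  proof -
    obtain y where y: "(T ^^ d) x = (T ^^ (d + m)) y" using range_stable[OF d, of m] by blast
    have "(T ^^ d) (B (T x)) = B (T ((T ^^ (d + m)) y))" by (simp only: Pn y)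
    also have "\<dots> = (T ^^ (d + m)) (B (T y))" by (simp only: Pn)
    also have "\<dots> = (T ^^ d) x" unfolding y by (simp add: funpow_add TBT)
    finally show ?thesis .
  qed
  then have "closed (range (T ^^ d))" using range_eq cl by simp
  then show "T \<in> right_drazin_ops" using T dsc by (simp add: right_drazin_ops_def d_def)
qed

section \<open>Drazin invertibility from powers\<close>

text \<open>
  The idempotent \<open>q = g y = z g\<close> is a two-sided unit for \<open>g\<close>, and \<open>w = z g y\<close> is the inverse of
  \<open>g\<close> with respect to it. Whatever commutes with \<open>g\<close> commutes with \<open>q\<close> and \<open>w\<close>; so \<open>a\<close> does, and
  \<open>w a\<^sup>n\<close> is a Drazin inverse of \<open>a\<close>.
\<close>

lemma drazin_invertible_if_power:
  assumes y: "g = g * g * y" and z: "g = z * g * g" and g: "g = (a::'a::complex_banach_algebra) ^ Suc n"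
  shows "drazin_invertible a"
proof -
  define q where "q = g * y"
  have ag: "a * g = g * a" by (simp only: g power_commutes)
  have q': "q = z * g" unfolding q_def by (metis y z mult.assoc)
  have qg: "q * g = g" using q' z by simp
  have gq: "g * q = g" using q_def y by (simp add: mult.assoc)
  define w where "w = z * g * y"
  have gw: "g * w = q" unfolding w_def using q' q_def gq by (metis mult.assoc)
  have wg: "w * g = q" unfolding w_def using q' q_def qg by (metis mult.assoc)
  have qw: "q * w = w" unfolding w_def using q' q_def qg by (metis mult.assoc)
  have wq: "w * q = w" unfolding w_def using q' q_def gq by (metis mult.assoc)
  have "q * (a * q) = a * q" using ag qg unfolding q_def by (metis mult.assoc)
  moreover have "(q * a) * q = q * a" using ag gq unfolding q' by (metis mult.assoc)
  ultimately have aq: "a * q = q * a" by (simp add: mult.assoc)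
  have "a * w = w * g * a * w" using aq qw wg by (metis mult.assoc)
  also have "\<dots> = w * a * q" using ag gw by (metis mult.assoc)
  also have "\<dots> = w * a" using aq wq by (metis mult.assoc)
  finally have aw: "a * w = w * a" .
  define b where "b = w * a ^ n"
  have ba: "b * a = q" unfolding b_def using wg g by (simp add: mult.assoc power_Suc2 del: power_Suc)
  have "a ^ n * w = w * a ^ n"
    by (induction n) (simp_all add: mult.assoc aw, metis mult.assoc aw)
  then have ab: "a * b = b * a" unfolding b_def using aw
    by (metis mult.assoc power_commutes)
  show ?thesis unfolding drazin_invertible_def
  proof (intro exI conjI)
    show "a ^ Suc n * b * a = a ^ Suc n" using ba gq by (simp only: g[symmetric] mult.assoc)
    show "b * a * b = b" using ba qw by (simp add: b_def flip: mult.assoc)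
    show "a * b = b * a" by (rule ab)
  qed
qed

lemma power_iterate_right:
  assumes "(a::'a::monoid_mult) ^ n = a ^ (n + 1) * c"
  shows "a ^ (n + k) * c ^ k = a ^ n"
proof (induction k)
  case (Suc k)
  have e: "n + Suc k = k + (n + 1)" by simp
  have "a ^ (n + Suc k) * c ^ Suc k = a ^ k * (a ^ (n + 1) * c) * c ^ k"
    unfolding e power_add[of a k] by (simp only: power_Suc mult.assoc)
  also have "\<dots> = a ^ (n + k) * c ^ k"
    unfolding assms[symmetric] by (simp only: power_add[symmetric] add.commute)
  finally show ?case using Suc by simp
qed simp

lemma power_iterate_left:
  assumes "(a::'a::monoid_mult) ^ n = c * a ^ (n + 1)"
  shows "c ^ k * a ^ (n + k) = a ^ n"
proof (induction k)
  case (Suc k)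
  have e: "n + Suc k = (n + 1) + k" by simp
  have "c ^ Suc k * a ^ (n + Suc k) = c ^ k * (c * a ^ (n + 1)) * a ^ k"
    unfolding e power_add[of a "n + 1"] by (simp only: power_Suc2 mult.assoc)
  also have "\<dots> = c ^ k * a ^ (n + k)"
    unfolding assms[symmetric] by (simp only: power_add mult.assoc)
  finally show ?case using Suc by simp
qed simp

text \<open>
  The hypothesis on \<open>g\<^sup>2 x = 0\<close> allows one factor \<open>g\<close> to be cancelled from the left of an equation
  between multiples of \<open>g\<^sup>2\<close>. Two cancellations give first \<open>g y g = g\<close> and then \<open>g y\<^sup>2 g = g y\<close>.
\<close>

lemma two_sided_from_right:
  fixes g y :: "'a::complex_banach_algebra"
  assumes y: "g = g * g * y" and inj: "\<And>x. g * g * x = 0 \<Longrightarrow> g * x = 0"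
  shows "g = g * y * y * g * g"
proof -
  have cancel: "g * u = g * v" if "g * g * u = g * g * v" for u v
    using inj[of "u - v"] that by (simp add: right_diff_distrib)
  have "g * g * (y * g) = g * g * 1" by (metis y mult.assoc mult_1_right)
  then have gyg: "g * y * g = g" using cancel by (metis mult.assoc mult_1_right)
  have "g * g * (y * y * g) = g * g * y" by (metis y gyg mult.assoc)
  then have "g * (y * y * g) = g * y" by (rule cancel)
  then show ?thesis using gyg by (metis mult.assoc)
qed

lemma two_sided_from_left:
  fixes g z :: "'a::complex_banach_algebra"
  assumes z: "g = z * g * g" and inj: "\<And>x. x * g * g = 0 \<Longrightarrow> x * g = 0"
  shows "g = g * g * (z * z * g)"
proof -
  have cancel: "u * g = v * g" if "u * g * g = v * g * g" for u v
    using inj[of "u - v"] that by (simp add: left_diff_distrib)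
  have "g * z * g * g = 1 * g * g" by (metis z mult.assoc mult_1_left)
  then have gzg: "g * z * g = g" using cancel by (metis mult_1_left)
  have "g * z * z * g * g = z * g * g" by (metis z gzg mult.assoc)
  then have "g * z * z * g = z * g" by (rule cancel)
  then show ?thesis using gzg by (metis mult.assoc)
qed

section \<open>The spectrum near a point where the element is Drazin invertible\<close>

lemma scaleC_ring_simps:
  fixes x y :: "'a::complex_banach_algebra"
  shows "(c *\<^sub>C x) * y = c *\<^sub>C (x * y)" "x * (c *\<^sub>C y) = c *\<^sub>C (x * y)"
    "c *\<^sub>C (x + y) = c *\<^sub>C x + c *\<^sub>C y" "c *\<^sub>C (x - y) = c *\<^sub>C x - c *\<^sub>C y"
    "c *\<^sub>C (d *\<^sub>C x) = (c * d) *\<^sub>C x" "1 *\<^sub>C x = x"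
  by (rule scaleC_mult_left scaleC_mult_right scaleC_add_right scaleC_diff_right scaleC_scaleC
      scaleC_one)+

lemma invertible_one_minus:
  fixes c :: "'a::complex_banach_algebra"
  assumes "norm c < 1"
  shows "invertible_elem (1 - c)"
proof -
  obtain z where z: "z = 1 + c * z"
    using affine_fixed_point[of "\<lambda>v. c * v" "norm c" 1] assms bounded_linear_mult_right
      norm_mult_ineq by auto
  obtain z' where z': "z' = 1 + z' * c"
    using affine_fixed_point[of "\<lambda>v. v * c" "norm c" 1] assms bounded_linear_mult_left
      norm_mult_ineq by (auto simp: mult.commute)
  have 1: "(1 - c) * z = 1" using z by (simp add: algebra_simps)
  have 2: "z' * (1 - c) = 1" using z' by (simp add: algebra_simps)
  have "z = z'" using 1 2 by (metis mult.assoc mult_1_left mult_1_right)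
  then show ?thesis using 1 2 unfolding invertible_elem_def by blast
qed

text \<open>
  The factor \<open>s\<close> is the geometric sum of the terms \<open>c\<^sup>i a\<^sup>m\<^sup>-\<^sup>1\<^sup>-\<^sup>i\<close>.
\<close>

lemma geometric_factor:
  fixes a :: "'a::complex_banach_algebra"
  obtains s where "(a - c *\<^sub>C 1) * s = a ^ m - (c ^ m) *\<^sub>C 1" "s * (a - c *\<^sub>C 1) = a ^ m - (c ^ m) *\<^sub>C 1"
proof -
  have "\<exists>s. (a - c *\<^sub>C 1) * s = a ^ m - (c ^ m) *\<^sub>C 1 \<and> s * (a - c *\<^sub>C 1) = a ^ m - (c ^ m) *\<^sub>C 1"
  proof (induction m)
    case 0 then show ?case by (intro exI[of _ 0]) (simp add: scaleC_ring_simps)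
  next
    case (Suc m)
    then obtain s where s: "(a - c *\<^sub>C 1) * s = a ^ m - (c ^ m) *\<^sub>C 1"
      "s * (a - c *\<^sub>C 1) = a ^ m - (c ^ m) *\<^sub>C 1" by blast
    have "(a - c *\<^sub>C 1) * (s * a + (c ^ m) *\<^sub>C 1) = ((a - c *\<^sub>C 1) * s) * a + (c ^ m) *\<^sub>C (a - c *\<^sub>C 1)"
      by (simp add: algebra_simps scaleC_ring_simps)
    moreover have "(s * a + (c ^ m) *\<^sub>C 1) * (a - c *\<^sub>C 1) = (s * (a - c *\<^sub>C 1)) * a + (c ^ m) *\<^sub>C (a - c *\<^sub>C 1)"
      by (simp add: algebra_simps scaleC_ring_simps)
    ultimately show ?case unfolding s
      by (intro exI[of _ "s * a + (c ^ m) *\<^sub>C 1"])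
        (simp add: algebra_simps scaleC_ring_simps power_commutes)
  qed
  then show ?thesis using that by blast
qed

text \<open>
  With \<open>p = ab\<close>, the part of \<open>a - c\<close> in the range of \<open>p\<close> is \<open>(a - c) b = p (1 - c b)\<close> up to the
  invertible factor \<open>b\<close>, and \<open>1 - c b\<close> is invertible for small \<open>c\<close>. In the range of \<open>1 - p\<close> the
  \<open>m\<close>-th power of \<open>a\<close> vanishes, so \<open>a\<^sup>m - c\<^sup>m\<close>, a multiple of \<open>a - c\<close>, acts there as the nonzero
  scalar \<open>- c\<^sup>m\<close>. A right and a left inverse of \<open>a - c\<close> are put together from these two parts.
\<close>

lemma drazin_invertible_punctured_resolvent:
  fixes a :: "'a::complex_banach_algebra"
  assumes "drazin_invertible a"
  obtains e where "0 < e" "\<And>c. c \<noteq> 0 \<Longrightarrow> cmod c < e \<Longrightarrow> invertible_elem (a - c *\<^sub>C 1)"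
proof -
  obtain b m where b: "a ^ m * b * a = a ^ m" "b * a * b = b" "a * b = b * a"
    using assms unfolding drazin_invertible_def by blast
  define p where "p = a * b"
  have amp: "a ^ m * (1 - p) = 0"
    using b by (simp add: p_def algebra_simps)
  have "a ^ m * p = p * a ^ m" unfolding p_def
    using b(3) by (metis mult.assoc power_commuting_commutes power_commutes)
  then have pam: "(1 - p) * a ^ m = 0" using amp by (simp add: algebra_simps)
  have bp: "b * p = b" "p * b = b" using b by (simp_all add: p_def mult.assoc)
  have "invertible_elem (a - c *\<^sub>C 1)" if c: "c \<noteq> 0" "cmod c < 1 / (norm b + 1)" for c
  proof -
    have "norm (c *\<^sub>C b) < 1"
    proof -
      have "cmod c * (norm b + 1) < 1"
        using c(2) norm_ge_zero[of b] by (subst (asm) pos_less_divide_eq) linarith+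
      then show ?thesis using norm_ge_zero[of c] by (simp add: norm_scaleC algebra_simps del: norm_ge_zero)
    qed
    then obtain u where u: "(1 - c *\<^sub>C b) * u = 1" "u * (1 - c *\<^sub>C b) = 1"
      using invertible_one_minus unfolding invertible_elem_def by blast
    obtain s where s: "(a - c *\<^sub>C 1) * s = a ^ m - (c ^ m) *\<^sub>C 1"
      "s * (a - c *\<^sub>C 1) = a ^ m - (c ^ m) *\<^sub>C 1" using geometric_factor .
    define t where "t = inverse (c ^ m)"
    have t: "t * c ^ m = 1" using c by (simp add: t_def)
    define x where "x = b * u - t *\<^sub>C (s * (1 - p))"
    define x' where "x' = u * b - t *\<^sub>C ((1 - p) * s)"
    have "(a - c *\<^sub>C 1) * b = p * (1 - c *\<^sub>C b)"
      using bp by (simp add: algebra_simps scaleC_ring_simps p_def)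
    then have "(a - c *\<^sub>C 1) * (b * u) = p" using u by (metis mult.assoc mult_1_right)
    moreover have "(a - c *\<^sub>C 1) * (t *\<^sub>C (s * (1 - p))) = - (1 - p)"
    proof -
      have "(a - c *\<^sub>C 1) * (t *\<^sub>C (s * (1 - p))) = t *\<^sub>C ((a ^ m - (c ^ m) *\<^sub>C 1) * (1 - p))"
        unfolding s(1)[symmetric] by (simp add: scaleC_ring_simps mult.assoc)
      also have "(a ^ m - (c ^ m) *\<^sub>C 1) * (1 - p) = 0 - (c ^ m) *\<^sub>C (1 - p)"
        unfolding left_diff_distrib amp by (simp add: scaleC_ring_simps)
      finally show ?thesis using t by (simp add: scaleC_ring_simps)
    qed
    ultimately have 1: "(a - c *\<^sub>C 1) * x = 1" unfolding x_def right_diff_distrib by simp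
    have "b * (a - c *\<^sub>C 1) = (1 - c *\<^sub>C b) * p"
      using bp b by (simp add: algebra_simps scaleC_ring_simps p_def)
    then have "(u * b) * (a - c *\<^sub>C 1) = p" using u by (metis mult.assoc mult_1_left)
    moreover have "(t *\<^sub>C ((1 - p) * s)) * (a - c *\<^sub>C 1) = - (1 - p)"
    proof -
      have "(t *\<^sub>C ((1 - p) * s)) * (a - c *\<^sub>C 1) = t *\<^sub>C ((1 - p) * (a ^ m - (c ^ m) *\<^sub>C 1))"
        unfolding s(2)[symmetric] by (simp add: scaleC_ring_simps mult.assoc)
      also have "(1 - p) * (a ^ m - (c ^ m) *\<^sub>C 1) = 0 - (c ^ m) *\<^sub>C (1 - p)"
        unfolding right_diff_distrib[of "1 - p"] pam by (simp add: scaleC_ring_simps)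
      finally show ?thesis using t by (simp add: scaleC_ring_simps)
    qed
    ultimately have 2: "x' * (a - c *\<^sub>C 1) = 1" unfolding x'_def left_diff_distrib by simp
    have "x = x'" using 1 2 by (metis mult.assoc mult_1_left mult_1_right)
    then show ?thesis using 1 2 unfolding invertible_elem_def by blast
  qed
  then show ?thesis using that[of "1 / (norm b + 1)"] by (simp add: add_nonneg_pos)
qed

text \<open>
  Each point is singled out by a member of a countable basis.
\<close>

lemma countable_if_discrete:
  fixes S :: "'a::second_countable_topology set"
  assumes "discrete S"
  shows "countable S"
proof -
  obtain \<B> :: "'a set set" where \<B>: "countable \<B>" "topological_basis \<B>"
    using ex_countable_basis by blast
  have "\<exists>U\<in>\<B>. U \<inter> S = {x}" if x: "x \<in> S" for x
  proof -
    obtain T where T: "open T" "T \<inter> S = {x}"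
      using discreteD[OF assms x] by (auto simp: isolated_in_def)
    then obtain U where "U \<in> \<B>" "x \<in> U" "U \<subseteq> T"
      using topological_basisE[OF \<B>(2) T(1), of x] by blast
    then show ?thesis using T x by blast
  qed
  then obtain U where U: "\<And>x. x \<in> S \<Longrightarrow> U x \<in> \<B> \<and> U x \<inter> S = {x}" by metis
  have "inj_on U S" by (rule inj_onI) (metis U singleton_inject)
  moreover have "countable (U ` S)" using U \<B>(1) by (meson countable_subset image_subsetI)
  ultimately show ?thesis using countable_image_inj_on by blast
qed

lemma shift_scalar:
  "(a::'a::complex_banach_algebra) - c *\<^sub>C 1 - d *\<^sub>C 1 = a - (c + d) *\<^sub>C 1"
  by (simp add: scaleC_add_left algebra_simps)

lemma drazin_spectrum_subset: "drazin_spectrum a \<subseteq> spectrum a"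
proof -
  have "drazin_invertible x" if inv: "invertible_elem x" for x :: 'a
  proof -
    obtain b where b: "x * b = 1" "b * x = 1" using inv unfolding invertible_elem_def by blast
    then have "x ^ 0 * b * x = x ^ 0 \<and> b * x * b = b \<and> x * b = b * x" by simp
    then show ?thesis unfolding drazin_invertible_def by blast
  qed
  then show ?thesis by (auto simp: drazin_spectrum_def spectrum_def)
qed

lemma countable_spectrum_minus_drazin_spectrum: "countable (spectrum a - drazin_spectrum a)"
proof (rule countable_if_discrete, rule discreteI)
  fix c assume c: "c \<in> spectrum a - drazin_spectrum a"
  then obtain e where e: "0 < e"
    "\<And>d. d \<noteq> 0 \<Longrightarrow> cmod d < e \<Longrightarrow> invertible_elem (a - c *\<^sub>C 1 - d *\<^sub>C 1)"
    using drazin_invertible_punctured_resolvent unfolding drazin_spectrum_def by blast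
  have "y = c" if "y \<in> spectrum a - drazin_spectrum a" "dist c y < e" for y
    using e(2)[of "y - c"] that
    by (auto simp: shift_scalar spectrum_def dist_norm norm_minus_commute)
  then show "c isolated_in (spectrum a - drazin_spectrum a)"
    unfolding isolated_in_dist_Ex_iff using c e(1) by blast
qed

section \<open>Multiplication operators\<close>

lemma left_mult_funpow: "(left_mult a ^^ n) x = a ^ n * x"
  by (induction n) (simp_all add: left_mult_def mult.assoc)

lemma right_mult_funpow: "(right_mult a ^^ n) x = x * a ^ n"
  by (induction n) (simp_all add: right_mult_def mult.assoc power_Suc2 del: power_Suc)

lemma op_minus_scalar_left_mult: "op_minus_scalar (left_mult a) c = left_mult (a - c *\<^sub>C 1)"
  by (auto simp: op_minus_scalar_def left_mult_def left_diff_distrib scaleC_ring_simps)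

lemma op_minus_scalar_right_mult: "op_minus_scalar (right_mult a) c = right_mult (a - c *\<^sub>C 1)"
  by (auto simp: op_minus_scalar_def right_mult_def right_diff_distrib scaleC_ring_simps)

lemma bij_left_mult:
  assumes "invertible_elem a" shows "bij (left_mult a)"
proof -
  obtain b where "a * b = 1" "b * a = 1" using assms unfolding invertible_elem_def by blast
  then show ?thesis
    by (intro o_bij[of "left_mult b"]) (auto simp: left_mult_def fun_eq_iff simp flip: mult.assoc)
qed

lemma bij_right_mult:
  assumes "invertible_elem a" shows "bij (right_mult a)"
proof -
  obtain b where "a * b = 1" "b * a = 1" using assms unfolding invertible_elem_def by blast
  then show ?thesis
    by (intro o_bij[of "right_mult b"]) (auto simp: right_mult_def fun_eq_iff mult.assoc)
qed

text \<open>
  Membership in either class of operators is thus reduced to the weakest of the conditions.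
\<close>

lemma finite_descent_if_drazin_ops:
  fixes T :: "'a::complex_banach \<Rightarrow> 'a"
  assumes lim: "\<And>\<epsilon>. 0 < \<epsilon> \<Longrightarrow> \<exists>c. cmod c < \<epsilon> \<and> bij (op_minus_scalar T c)"
    and T: "T \<in> left_drazin_ops \<union> right_drazin_ops"
  shows "descent T < \<infinity>"
proof (cases "T \<in> left_drazin_ops")
  case True
  then have "range (T ^^ the_enat (ascent T)) = range (T ^^ (the_enat (ascent T) + 1))"
    using lim unfolding left_drazin_ops_def bij_def
    by (intro finite_ascent_closed_range_imp_descent null_space_ascent) blast+
  then show ?thesis unfolding descent_finite_iff by (rule exI)
next
  case False
  then show ?thesis using T by (simp add: right_drazin_ops_def)
qed

text \<open>
  Evaluating the equality of ranges at the unit gives \<open>a\<^sup>n = a\<^sup>n\<^sup>+\<^sup>1 c\<close>, so left multiplication by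
  \<open>c\<close> is the operator that witnesses finite descent, and the null spaces are stable from \<open>n\<close> on.
  Both facts are transported to the pair \<open>n\<close> and \<open>2n\<close>, that is, to \<open>g = a\<^sup>n\<close> and its square.
\<close>

lemma drazin_invertible_if_left_mult_descent:
  fixes a :: "'a::complex_banach_algebra"
  assumes lim: "\<And>\<epsilon>. 0 < \<epsilon> \<Longrightarrow> \<exists>c. cmod c < \<epsilon> \<and> bij (op_minus_scalar (left_mult a) c)"
    and dsc: "descent (left_mult a) < \<infinity>"
  shows "drazin_invertible a"
proof -
  obtain n0 where n0: "range (left_mult a ^^ n0) = range (left_mult a ^^ (n0 + 1))"
    using dsc unfolding descent_finite_iff by blast
  \<comment> \<open>the construction of the Drazin inverse from a power needs a positive exponent\<close>
  have "range (left_mult a ^^ Suc n0) = range (left_mult a ^^ (Suc n0 + 1))"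
    using range_stable[OF n0, of 1] range_stable[OF n0, of 2] by simp
  then obtain n where n: "n = Suc n0" "range (left_mult a ^^ n) = range (left_mult a ^^ (n + 1))"
    by blast
  have "a ^ n \<in> range (left_mult a ^^ n)" by (metis left_mult_funpow mult_1_right rangeI)
  then obtain c where "a ^ n = (left_mult a ^^ (n + 1)) c" unfolding n(2) by (rule rangeE)
  then have c: "a ^ n = a ^ (n + 1) * c" by (simp only: left_mult_funpow)
  have "null_space (left_mult a ^^ n) = null_space (left_mult a ^^ (n + 1))"
  proof (rule finite_descent_imp_null_space)
    show "bounded_linear (left_mult c)"
      using bounded_clinear_left_mult[of c] by (simp add: bounded_clinear_def)
    show "(left_mult a ^^ n) x = (left_mult a ^^ (n + 1)) (left_mult c x)" for x
      unfolding left_mult_funpow c by (simp add: left_mult_def mult.assoc)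
    show "\<exists>\<mu>. cmod \<mu> < \<epsilon> \<and> inj (op_minus_scalar (left_mult a) \<mu>)" if "0 < \<epsilon>" for \<epsilon>
      using lim[OF that] by (auto simp: bij_def)
  qed (rule bounded_clinear_left_mult)
  then have N: "a ^ n * x = 0" if "a ^ (n + n) * x = 0" for x
    using null_space_stable[of n "left_mult a" n] that
    by (auto simp: null_space_def left_mult_funpow set_eq_iff)
  have y: "a ^ n = a ^ n * a ^ n * c ^ n"
    using power_iterate_right[OF c, of n] by (simp add: power_add)
  show ?thesis
    by (rule drazin_invertible_if_power[OF y two_sided_from_right[OF y] n(1)[THEN arg_cong]])
      (use N in \<open>simp add: power_add\<close>)
qed

lemma drazin_invertible_if_right_mult_descent:
  fixes a :: "'a::complex_banach_algebra"
  assumes lim: "\<And>\<epsilon>. 0 < \<epsilon> \<Longrightarrow> \<exists>c. cmod c < \<epsilon> \<and> bij (op_minus_scalar (right_mult a) c)"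
    and dsc: "descent (right_mult a) < \<infinity>"
  shows "drazin_invertible a"
proof -
  obtain n0 where n0: "range (right_mult a ^^ n0) = range (right_mult a ^^ (n0 + 1))"
    using dsc unfolding descent_finite_iff by blast
  \<comment> \<open>the construction of the Drazin inverse from a power needs a positive exponent\<close>
  have "range (right_mult a ^^ Suc n0) = range (right_mult a ^^ (Suc n0 + 1))"
    using range_stable[OF n0, of 1] range_stable[OF n0, of 2] by simp
  then obtain n where n: "n = Suc n0" "range (right_mult a ^^ n) = range (right_mult a ^^ (n + 1))"
    by blast
  have "a ^ n \<in> range (right_mult a ^^ n)" by (metis right_mult_funpow mult_1_left rangeI)
  then obtain c where "a ^ n = (right_mult a ^^ (n + 1)) c" unfolding n(2) by (rule rangeE)
  then have c: "a ^ n = c * a ^ (n + 1)" by (simp only: right_mult_funpow)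
  have "null_space (right_mult a ^^ n) = null_space (right_mult a ^^ (n + 1))"
  proof (rule finite_descent_imp_null_space)
    show "bounded_linear (right_mult c)"
      using bounded_clinear_right_mult[of c] by (simp add: bounded_clinear_def)
    show "(right_mult a ^^ n) x = (right_mult a ^^ (n + 1)) (right_mult c x)" for x
      unfolding right_mult_funpow c by (simp add: right_mult_def mult.assoc)
    show "\<exists>\<mu>. cmod \<mu> < \<epsilon> \<and> inj (op_minus_scalar (right_mult a) \<mu>)" if "0 < \<epsilon>" for \<epsilon>
      using lim[OF that] by (auto simp: bij_def)
  qed (rule bounded_clinear_right_mult)
  then have N: "x * a ^ n = 0" if "x * a ^ (n + n) = 0" for x
    using null_space_stable[of n "right_mult a" n] that
    by (auto simp: null_space_def right_mult_funpow set_eq_iff)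
  have z: "a ^ n = c ^ n * a ^ n * a ^ n"
    using power_iterate_left[OF c, of n] by (simp add: power_add mult.assoc)
  show ?thesis
    by (rule drazin_invertible_if_power[OF two_sided_from_left[OF z] z n(1)[THEN arg_cong]])
      (use N in \<open>simp add: power_add mult.assoc\<close>)
qed

lemma drazin_invertible_imp_mult_drazin_ops:
  fixes a :: "'a::complex_banach_algebra"
  assumes "drazin_invertible a"
  shows "left_mult a \<in> left_drazin_ops \<inter> right_drazin_ops"
    "right_mult a \<in> left_drazin_ops \<inter> right_drazin_ops"
proof -
  obtain b m where b: "a ^ m * b * a = a ^ m" "b * a * b = b" "a * b = b * a"
    using assms unfolding drazin_invertible_def by blast
  have bab: "a * b * a ^ m = a ^ m"
    using b by (metis mult.assoc power_commuting_commutes)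
  have bl: "bounded_linear (left_mult b)" "bounded_linear (right_mult b)"
    using bounded_clinear_left_mult bounded_clinear_right_mult unfolding bounded_clinear_def by blast+
  have "(left_mult a ^^ m) (left_mult b (left_mult a x)) = (left_mult a ^^ m) x"
    "left_mult b (left_mult a (left_mult b x)) = left_mult b x"
    "left_mult a (left_mult b x) = left_mult b (left_mult a x)" for x
    unfolding left_mult_funpow unfolding left_mult_def using b by (metis mult.assoc)+
  then show "left_mult a \<in> left_drazin_ops \<inter> right_drazin_ops"
    using drazin_inverse_imp_drazin_ops[OF bounded_clinear_left_mult bl(1)] by blast
  have "(right_mult a ^^ m) (right_mult b (right_mult a x)) = (right_mult a ^^ m) x"
    "right_mult b (right_mult a (right_mult b x)) = right_mult b x"
    "right_mult a (right_mult b x) = right_mult b (right_mult a x)" for x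
    unfolding right_mult_funpow unfolding right_mult_def using b bab by (metis mult.assoc)+
  then show "right_mult a \<in> left_drazin_ops \<inter> right_drazin_ops"
    using drazin_inverse_imp_drazin_ops[OF bounded_clinear_right_mult bl(2)] by blast
qed

section \<open>Equality of the spectra\<close>

text \<open>
  At each \<open>c\<close> the conditions form a cycle: Drazin invertibility implies membership in both classes
  of operators, each of these implies finite descent, and finite descent implies Drazin
  invertibility. That \<open>c\<close> is a limit of points outside the spectrum is used twice: in passing from
  \<open>left_drazin_ops\<close> to finite descent, and in the last implication.
\<close>

lemma drazin_spectrum_eq_if_countable:
  fixes a :: "'a::complex_banach_algebra"
  assumes "countable (spectrum a)"
  shows "drazin_spectrum a = left_drazin_spectrum (left_mult a)"
    "drazin_spectrum a = right_drazin_spectrum (left_mult a)"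
    "drazin_spectrum a = descent_spectrum (left_mult a)"
    "drazin_spectrum a = left_drazin_spectrum (right_mult a)"
    "drazin_spectrum a = right_drazin_spectrum (right_mult a)"
    "drazin_spectrum a = descent_spectrum (right_mult a)"
proof -
  have near: "\<exists>d. cmod d < \<epsilon> \<and> invertible_elem (a - c *\<^sub>C 1 - d *\<^sub>C 1)" if \<epsilon>: "0 < \<epsilon>" for \<epsilon> c
  proof -
    obtain y where "y \<in> ball c \<epsilon>" "y \<notin> spectrum a"
      using ball_minus_countable_nonempty[OF assms \<epsilon>, of c] by blast
    then show ?thesis
      by (intro exI[of _ "y - c"])
        (auto simp: shift_scalar spectrum_def dist_norm norm_minus_commute)
  qed
  have limL: "\<exists>d. cmod d < \<epsilon> \<and> bij (op_minus_scalar (left_mult (a - c *\<^sub>C 1)) d)" if "0 < \<epsilon>" for \<epsilon> c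
    using near[OF that, of c] bij_left_mult unfolding op_minus_scalar_left_mult by blast
  have limR: "\<exists>d. cmod d < \<epsilon> \<and> bij (op_minus_scalar (right_mult (a - c *\<^sub>C 1)) d)" if "0 < \<epsilon>" for \<epsilon> c
    using near[OF that, of c] bij_right_mult unfolding op_minus_scalar_right_mult by blast
  have L: "drazin_invertible (a - c *\<^sub>C 1) \<longleftrightarrow> left_mult (a - c *\<^sub>C 1) \<in> left_drazin_ops"
    "drazin_invertible (a - c *\<^sub>C 1) \<longleftrightarrow> left_mult (a - c *\<^sub>C 1) \<in> right_drazin_ops"
    "drazin_invertible (a - c *\<^sub>C 1) \<longleftrightarrow> descent (left_mult (a - c *\<^sub>C 1)) < \<infinity>" for c
    using drazin_invertible_imp_mult_drazin_ops(1)[of "a - c *\<^sub>C 1"]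
      finite_descent_if_drazin_ops[OF limL[of _ c]] drazin_invertible_if_left_mult_descent[OF limL[of _ c]]
    by blast+
  have R: "drazin_invertible (a - c *\<^sub>C 1) \<longleftrightarrow> right_mult (a - c *\<^sub>C 1) \<in> left_drazin_ops"
    "drazin_invertible (a - c *\<^sub>C 1) \<longleftrightarrow> right_mult (a - c *\<^sub>C 1) \<in> right_drazin_ops"
    "drazin_invertible (a - c *\<^sub>C 1) \<longleftrightarrow> descent (right_mult (a - c *\<^sub>C 1)) < \<infinity>" for c
    using drazin_invertible_imp_mult_drazin_ops(2)[of "a - c *\<^sub>C 1"]
      finite_descent_if_drazin_ops[OF limR[of _ c]] drazin_invertible_if_right_mult_descent[OF limR[of _ c]]
    by blast+
  note spectra = drazin_spectrum_def left_drazin_spectrum_def right_drazin_spectrum_def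
    descent_spectrum_def op_minus_scalar_left_mult op_minus_scalar_right_mult
  show "drazin_spectrum a = left_drazin_spectrum (left_mult a)" by (simp add: spectra L(1))
  show "drazin_spectrum a = right_drazin_spectrum (left_mult a)" by (simp add: spectra L(2))
  show "drazin_spectrum a = descent_spectrum (left_mult a)" by (simp add: spectra L(3))
  show "drazin_spectrum a = left_drazin_spectrum (right_mult a)" by (simp add: spectra R(1))
  show "drazin_spectrum a = right_drazin_spectrum (right_mult a)" by (simp add: spectra R(2))
  show "drazin_spectrum a = descent_spectrum (right_mult a)" by (simp add: spectra R(3))
qed

theorem theorem2p2:
  fixes a :: "'a::complex_banach_algebra"
  shows "(countable (spectrum a) \<longleftrightarrow> countable (drazin_spectrum a)) \<and>
    (countable (spectrum a) \<longrightarrow>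
       drazin_spectrum a = left_drazin_spectrum (left_mult a) \<and>
       left_drazin_spectrum (left_mult a) = right_drazin_spectrum (left_mult a) \<and>
       right_drazin_spectrum (left_mult a) = descent_spectrum (left_mult a) \<and>
       descent_spectrum (left_mult a) = left_drazin_spectrum (right_mult a) \<and>
       left_drazin_spectrum (right_mult a) = right_drazin_spectrum (right_mult a) \<and>
       right_drazin_spectrum (right_mult a) = descent_spectrum (right_mult a))"
proof -
  have "countable (spectrum a) \<longleftrightarrow> countable (drazin_spectrum a)"
  proof
    assume "countable (drazin_spectrum a)"
    then have "countable (drazin_spectrum a \<union> (spectrum a - drazin_spectrum a))"
      using countable_spectrum_minus_drazin_spectrum by (rule countable_Un)
    then show "countable (spectrum a)" by (rule countable_subset[rotated]) blast
  qed (rule countable_subset[OF drazin_spectrum_subset])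
  then show ?thesis
    using drazin_spectrum_eq_if_countable[of a, symmetric] by (simp cong: conj_cong)
qed

end
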